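(* Let $G$ be a simple mixed graph with integrated adjacency matrix $\mathcal{I}(G)$ and largest $\mathcal{I}$-eigenvalue $\boldsymbol{\lambda}_1(G)$. Let $p^-,p^0,p^+$ denote the numbers of eigenvalues of $\mathcal{I}(G)$ (with multiplicity) which are less than, equal to and greater than $0$, respectively, and let $q^-,q^0,q^+$ denote the numbers of eigenvalues of $\mathcal{I}(G)$ (with multiplicity) which are less than, equal to and greater than $-2$, respectively. Let $$s=\min\left\{1+\frac{\boldsymbol{\lambda}_1(G)}{2},\ \frac{p^0+p^-+1}{2},\ p^0+p^+-1,\ q^0+q^-+1,\ \frac{q^0+q^+}{2}\right\}.$$ Then the clique number of $G$ satisfies $\omega(G)\le s$.
   Context: A mixed graph $G$ has a finite nonempty vertex set $V_G=\{v_1,\dots,v_n\}$, a finite set $E_G$ of (undirected) edges, each joining an unordered pair of vertices $\{u,v\}$ (a loop if $u=v$), and a finite set $\vec E_G$ of arcs, each going from $u$ to $v$ for an ordered pair $(u,v)$ of vertices (a directed loop if $u=v$); multiple edges, loops, arcs and directed loops are allowed. $G$ is simple if it has no loops, no directed loops, at most one edge joining any two vertices, and at most one arc from $u$ to $v$ for each ordered pair $(u,v)$ (an edge and arcs in both directions may coexist on the same pair of vertices). The integrated adjacency matrix $\mathcal{I}(G)$ is the real symmetric $2n\times 2n$ matrix $\begin{bmatrix}A&D\\ D^T&A\end{bmatrix}$, where $A_{ij}$ ($i\neq j$) is the number of edges joining $v_i$ and $v_j$, $A_{ii}$ is twice the number of loops at $v_i$, and $D_{ij}$ is the number of arcs from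 $v_i$ to $v_j$. Its eigenvalues are the $\mathcal{I}$-eigenvalues of $G$. A complete mixed graph is a simple mixed graph in which, for every pair of distinct vertices $u,v$, there are an edge joining $u$ and $v$, an arc from $u$ to $v$, and an arc from $v$ to $u$. A clique of a simple mixed graph $G$ is a submixed graph of $G$ (subsets of vertices, edges and arcs with the restricted incidences) that is a complete mixed graph. The clique number $\omega(G)$ is the number of vertices in a largest clique of $G$. *)

theory Defs
  imports "Jordan_Normal_Form.Spectral_Radius" "HOL-Library.Uprod"
begin

text \<open>Edges and arcs are identified by names, so multiple edges and arcs are allowed.  An edge whose
  end pair is \<open>Upair v v\<close> is a loop at \<open>v\<close>.\<close>

record ('v, 'e, 'a) mixed_graph =
  verts :: "'v set"
  edges :: "'e set"
  arcs :: "'a set"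
  ends :: "'e \<Rightarrow> 'v uprod"
  tail :: "'a \<Rightarrow> 'v"
  head :: "'a \<Rightarrow> 'v"

definition wf_mixed_graph :: "('v, 'e, 'a) mixed_graph \<Rightarrow> bool" where
  "wf_mixed_graph G \<longleftrightarrow>
     finite (verts G) \<and> verts G \<noteq> {} \<and> finite (edges G) \<and> finite (arcs G) \<and>
     (\<forall>e\<in>edges G. set_uprod (ends G e) \<subseteq> verts G) \<and>
     (\<forall>a\<in>arcs G. tail G a \<in> verts G \<and> head G a \<in> verts G)"

definition edges_joining :: "('v, 'e, 'a) mixed_graph \<Rightarrow> 'v \<Rightarrow> 'v \<Rightarrow> 'e set" where
  "edges_joining G u v = {e \<in> edges G. ends G e = Upair u v}"

definition arcs_from_to :: "('v, 'e, 'a) mixed_graph \<Rightarrow> 'v \<Rightarrow> 'v \<Rightarrow> 'a set" where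
  "arcs_from_to G u v = {a \<in> arcs G. tail G a = u \<and> head G a = v}"

definition simple_mixed_graph :: "('v, 'e, 'a) mixed_graph \<Rightarrow> bool" where
  "simple_mixed_graph G \<longleftrightarrow> wf_mixed_graph G \<and>
     (\<forall>v\<in>verts G. edges_joining G v v = {} \<and> arcs_from_to G v v = {}) \<and>
     (\<forall>u\<in>verts G. \<forall>v\<in>verts G. card (edges_joining G u v) \<le> 1 \<and> card (arcs_from_to G u v) \<le> 1)"

definition complete_mixed_graph :: "('v, 'e, 'a) mixed_graph \<Rightarrow> bool" where
  "complete_mixed_graph G \<longleftrightarrow> simple_mixed_graph G \<and>
     (\<forall>u\<in>verts G. \<forall>v\<in>verts G. u \<noteq> v \<longrightarrow>
        edges_joining G u v \<noteq> {} \<and> arcs_from_to G u v \<noteq> {} \<and> arcs_from_to G v u \<noteq> {})"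

definition submixed_graph :: "('v, 'e, 'a) mixed_graph \<Rightarrow> ('v, 'e, 'a) mixed_graph \<Rightarrow> bool" where
  "submixed_graph H G \<longleftrightarrow> wf_mixed_graph H \<and> wf_mixed_graph G \<and>
     verts H \<subseteq> verts G \<and> edges H \<subseteq> edges G \<and> arcs H \<subseteq> arcs G \<and>
     (\<forall>e\<in>edges H. ends H e = ends G e) \<and>
     (\<forall>a\<in>arcs H. tail H a = tail G a \<and> head H a = head G a)"

definition clique :: "('v, 'e, 'a) mixed_graph \<Rightarrow> ('v, 'e, 'a) mixed_graph \<Rightarrow> bool" where
  "clique G H \<longleftrightarrow> submixed_graph H G \<and> complete_mixed_graph H"

definition clique_number :: "('v, 'e, 'a) mixed_graph \<Rightarrow> nat" where
  "clique_number G = Max {card (verts H) | H. clique G H}"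

text \<open>The matrices depend on an enumeration \<open>vs\<close> of the vertices, given as a list without
  repetitions.\<close>

definition edge_matrix :: "('v, 'e, 'a) mixed_graph \<Rightarrow> 'v list \<Rightarrow> real mat" where
  "edge_matrix G vs = mat (length vs) (length vs) (\<lambda>(i, j).
     if i = j then 2 * real (card (edges_joining G (vs ! i) (vs ! i)))
     else real (card (edges_joining G (vs ! i) (vs ! j))))"

definition arc_matrix :: "('v, 'e, 'a) mixed_graph \<Rightarrow> 'v list \<Rightarrow> real mat" where
  "arc_matrix G vs = mat (length vs) (length vs) (\<lambda>(i, j).
     real (card (arcs_from_to G (vs ! i) (vs ! j))))"

definition integrated_adjacency_matrix :: "('v, 'e, 'a) mixed_graph \<Rightarrow> 'v list \<Rightarrow> real mat" where
  "integrated_adjacency_matrix G vs =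
     four_block_mat (edge_matrix G vs) (arc_matrix G vs)
       (transpose_mat (arc_matrix G vs)) (edge_matrix G vs)"

text \<open>Only real eigenvalues are counted, which for a real symmetric matrix is all of them.
  The name \<open>order\<close> is qualified to avoid the order of a group.\<close>

definition num_eigenvalues :: "real mat \<Rightarrow> (real \<Rightarrow> bool) \<Rightarrow> nat" where
  "num_eigenvalues M P = (\<Sum>x\<in>{x \<in> spectrum M. P x}. Polynomial.order x (char_poly M))"

definition largest_eigenvalue :: "real mat \<Rightarrow> real" where
  "largest_eigenvalue M = Max (spectrum M)"

end

theory Submission
  imports Defs
begin

text \<open>Let \<open>w\<close> be the clique number.  Restricting the quadratic form \<open>x \<bullet> M x\<close> to vectors supported on the
  two copies of a largest clique leaves, with \<open>y i\<close> and \<open>z i\<close> the two coordinates at the vertex \<open>i\<close> and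
  \<open>u i = y i + z i\<close>, the form \<open>(\<Sum>i. u i)\<^sup>2 - (\<Sum>i. (u i)\<^sup>2)\<close> on a space of dimension \<open>2 w\<close>
  (\<open>form_supported\<close>).  Each of the five bounds comes from a subspace on which the Rayleigh quotient of
  this form is controlled:

  \<^item> on the vectors with all \<open>y i\<close> and \<open>z i\<close> equal (dimension 1) it is \<open>2 (w - 1)\<close>;
  \<^item> on \<open>(\<Sum>i. u i) = 0\<close> (dimension \<open>2 w - 1\<close>) it is at most 0;
  \<^item> where all \<open>u i\<close> are equal (dimension \<open>w + 1\<close>) it is at least 0;
  \<^item> on \<open>y = z\<close>, \<open>(\<Sum>i. u i) = 0\<close> (dimension \<open>w - 1\<close>) it is \<open>-2\<close>;
  \<^item> on the whole space (dimension \<open>2 w\<close>) it is at least \<open>-2\<close>.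

  A subspace of dimension \<open>k\<close> on which the Rayleigh quotient is at most (at least) \<open>c\<close> forces \<open>k\<close>
  eigenvalues that are at most (at least) \<open>c\<close>: otherwise it meets the span of the remaining eigenvectors
  in a nonzero vector, whose Rayleigh quotient lies strictly on the other side of \<open>c\<close>
  (\<open>num_eigenvalues_le_bound\<close>, \<open>num_eigenvalues_ge_bound\<close>).  That argument needs an orthonormal
  eigenbasis (\<open>symmetric_orthogonal_diagonalization\<close>).\<close>

section \<open>Orthogonal diagonalization of real symmetric matrices\<close>

text \<open>The Hermitian form \<open>v\<^sup>* A v\<close> at an eigenvector \<open>v\<close> equals \<open>k * N\<close> with \<open>N > 0\<close> the squared norm of
  \<open>v\<close>, and it is its own conjugate because \<open>A\<close> is real and symmetric.\<close>

lemma real_symmetric_complex_eigenvalue_real: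
  fixes A :: "real mat"
  assumes A: "A \<in> carrier_mat n n" and sym: "transpose_mat A = A"
    and ev: "eigenvalue (map_mat complex_of_real A) k"
  shows "k = of_real (Re k)"
proof -
  let ?A = "map_mat complex_of_real A"
  obtain v where v: "v \<in> carrier_vec n" "v \<noteq> 0\<^sub>v n" and Av: "?A *\<^sub>v v = k \<cdot>\<^sub>v v"
    using ev A unfolding eigenvalue_def eigenvector_def by auto
  have a: "A $$ (i, j) = A $$ (j, i)" if "i < n" "j < n" for i j
    using that A arg_cong[OF sym, of "\<lambda>B. B $$ (i, j)"] by simp
  have row: "(\<Sum>j\<in>{0..<n}. of_real (A $$ (i, j)) * v $ j) = k * v $ i" if i: "i < n" for i
    using arg_cong[OF Av, of "\<lambda>w. w $ i"] A v(1) i by (simp add: scalar_prod_def)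
  define N where "N = (\<Sum>i\<in>{0..<n}. cnj (v $ i) * v $ i)"
  define S where "S = (\<Sum>i\<in>{0..<n}. \<Sum>j\<in>{0..<n}. cnj (v $ i) * of_real (A $$ (i, j)) * v $ j)"
  have S: "S = k * N"
    unfolding S_def N_def sum_distrib_left
  proof (rule sum.cong[OF refl])
    fix i assume "i \<in> {0..<n}"
    hence i: "i < n" by simp
    have "(\<Sum>j\<in>{0..<n}. cnj (v $ i) * of_real (A $$ (i, j)) * v $ j)
        = cnj (v $ i) * (\<Sum>j\<in>{0..<n}. of_real (A $$ (i, j)) * v $ j)"
      by (simp add: sum_distrib_left mult.assoc)
    thus "(\<Sum>j\<in>{0..<n}. cnj (v $ i) * of_real (A $$ (i, j)) * v $ j) = k * (cnj (v $ i) * v $ i)"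
      using row[OF i] by simp
  qed
  have "cnj S = (\<Sum>i\<in>{0..<n}. \<Sum>j\<in>{0..<n}. cnj (v $ j) * of_real (A $$ (j, i)) * v $ i)"
    unfolding S_def cnj_sum by (intro sum.cong refl) (simp add: a)
  also have "\<dots> = S" unfolding S_def by (rule sum.swap)
  finally have "cnj S = S" .
  moreover have "cnj N = N" unfolding N_def cnj_sum by (intro sum.cong refl) simp
  ultimately have "cnj k * N = k * N" using S by (metis complex_cnj_mult)
  moreover have "N \<noteq> 0"
  proof
    assume "N = 0"
    have N: "N = of_real (\<Sum>i\<in>{0..<n}. (cmod (v $ i))\<^sup>2)"
      unfolding N_def of_real_sum by (intro sum.cong refl) (metis complex_norm_square mult.commute)
    hence "(\<Sum>i\<in>{0..<n}. (cmod (v $ i))\<^sup>2) = 0" using \<open>N = 0\<close> by (metis of_real_eq_0_iff)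
    hence "\<forall>i\<in>{0..<n}. (cmod (v $ i))\<^sup>2 = 0" by (subst (asm) sum_nonneg_eq_0_iff) auto
    hence "v = 0\<^sub>v n" using v(1) by (intro eq_vecI) auto
    thus False using v(2) by simp
  qed
  ultimately have "cnj k = k" by simp
  thus ?thesis by (metis Reals_cnj_iff of_real_Re)
qed

text \<open>Over the complex numbers the characteristic polynomial has a root; that root is real, so it is a
  root over the reals as well and comes with a real eigenvector, which can be normalized.\<close>

lemma symmetric_unit_eigenvector:
  fixes A :: "real mat"
  assumes A: "A \<in> carrier_mat n n" and sym: "transpose_mat A = A" and n: "n > 0"
  obtains v k where "v \<in> carrier_vec n" "v \<bullet> v = 1" "A *\<^sub>v v = k \<cdot>\<^sub>v v"
proof -
  let ?A = "map_mat complex_of_real A"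
  have cA: "?A \<in> carrier_mat n n" using A by simp
  obtain z where ev: "eigenvalue ?A z"
    using spectrum_non_empty[OF cA n] unfolding spectrum_def by auto
  define k where "k = Re z"
  have z: "z = of_real k"
    using real_symmetric_complex_eigenvalue_real[OF A sym ev] unfolding k_def .
  have "poly (map_poly complex_of_real (char_poly A)) (of_real k) = 0"
    using ev unfolding eigenvalue_root_char_poly[OF cA] of_real_hom.char_poly_hom[OF A] z .
  hence "poly (char_poly A) k = 0" by simp
  then obtain u where u: "u \<in> carrier_vec n" "u \<noteq> 0\<^sub>v n" and Au: "A *\<^sub>v u = k \<cdot>\<^sub>v u"
    using A unfolding eigenvalue_root_char_poly[OF A, symmetric] eigenvalue_def eigenvector_def by auto
  have pos: "u \<bullet> u > 0"
  proof -
    obtain i where i: "i < n" "u $ i \<noteq> 0" using u by (metis carrier_vecD eq_vecI index_zero_vec)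
    have "0 < (u $ i)\<^sup>2" using i by simp
    also have "\<dots> \<le> (\<Sum>i\<in>{0..<n}. (u $ i)\<^sup>2)" using i by (intro member_le_sum) auto
    finally show ?thesis using u(1) by (simp add: scalar_prod_def power2_eq_square)
  qed
  define r where "r = 1 / sqrt (u \<bullet> u)"
  have r: "r * (r * (u \<bullet> u)) = 1" using pos unfolding r_def by (simp add: field_simps)
  show thesis
  proof
    show "r \<cdot>\<^sub>v u \<in> carrier_vec n" using u by simp
    show "(r \<cdot>\<^sub>v u) \<bullet> (r \<cdot>\<^sub>v u) = 1"
      using u(1) r by (simp add: smult_scalar_prod_distrib[of _ n] scalar_prod_smult_distrib[of _ n])
    show "A *\<^sub>v (r \<cdot>\<^sub>v u) = k \<cdot>\<^sub>v (r \<cdot>\<^sub>v u)"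
      using u(1) A Au by (simp add: mult_mat_vec[of _ n n] smult_smult_assoc mult.commute)
  qed
qed

text \<open>This completes a unit vector to an orthonormal basis in closed form, without the Gram-Schmidt
  process: the reflection in the hyperplane orthogonal to \<open>w = v - e\<^sub>0\<close> exchanges \<open>e\<^sub>0\<close> and \<open>v\<close>.  Being
  symmetric and an involution, it is its own transpose and its own inverse.\<close>

lemma householder_reflection:
  fixes v :: "real vec"
  assumes v: "v \<in> carrier_vec (Suc m)" and unit: "v \<bullet> v = 1"
  obtains Q where "Q \<in> carrier_mat (Suc m) (Suc m)" "transpose_mat Q = Q" "Q * Q = 1\<^sub>m (Suc m)"
    "Q *\<^sub>v unit_vec (Suc m) 0 = v"
proof -
  let ?n = "Suc m"
  let ?d = "\<lambda>i j. if i = j then 1 else 0 :: real"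
  define w where "w i = v $ i - ?d i 0" for i
  define N where "N = (\<Sum>i\<in>{0..<?n}. w i * w i)"
  \<comment> \<open>If \<open>w = 0\<close>, that is \<open>v = e\<^sub>0\<close>, then \<open>N = 0\<close> and division by zero makes \<open>c = 0\<close>, so that \<open>Q\<close> is the
    identity, as it should be.\<close>
  define c where "c = 2 / N"
  define Q where "Q = mat ?n ?n (\<lambda>(i, j). ?d i j - c * w i * w j)"
  have vv: "(\<Sum>i\<in>{0..<?n}. v $ i * v $ i) = 1" using unit v by (simp add: scalar_prod_def)
  have "N = (\<Sum>i\<in>{0..<?n}. v $ i * v $ i - 2 * (v $ i * ?d i 0) + ?d i 0)"
    unfolding N_def w_def by (intro sum.cong) (auto simp: algebra_simps)
  also have "\<dots> = 2 - 2 * v $ 0"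
    unfolding sum.distrib sum_subtractf vv sum_distrib_left[symmetric]
    by (simp add: if_distrib[of "\<lambda>x. _ * x"] cong: if_cong)
  finally have N: "N = 2 - 2 * v $ 0" .
  have cN: "c * c * N = 2 * c" unfolding c_def by simp
  show thesis
  proof
    show Q: "Q \<in> carrier_mat ?n ?n" unfolding Q_def by simp
    show "transpose_mat Q = Q" unfolding Q_def by (intro eq_matI) auto
    show "Q * Q = 1\<^sub>m ?n"
    proof (intro eq_matI)
      fix i j assume "i < dim_row (1\<^sub>m ?n)" "j < dim_col (1\<^sub>m ?n :: real mat)"
      hence i: "i < ?n" and j: "j < ?n" by auto
      have "(Q * Q) $$ (i, j)
          = (\<Sum>k\<in>{0..<?n}. (?d i k - c * w i * w k) * (?d k j - c * w k * w j))"
        unfolding Q_def using i j by (simp add: scalar_prod_def del: sum.op_ivl_Suc)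
      also have "\<dots> = (\<Sum>k\<in>{0..<?n}. (if k = i then ?d i j - c * w i * w j else 0)
          - (if k = j then c * w i * w j else 0) + (c * c * w i * w j) * (w k * w k))"
        by (intro sum.cong refl) (auto simp: algebra_simps)
      also have "\<dots> = ?d i j - c * w i * w j - c * w i * w j + c * c * w i * w j * N"
        unfolding sum.distrib sum_subtractf sum_distrib_left[symmetric] N_def[symmetric]
        using i j by (simp del: sum.op_ivl_Suc)
      also have "\<dots> = ?d i j + (c * c * N - 2 * c) * (w i * w j)" by (simp add: algebra_simps)
      finally show "(Q * Q) $$ (i, j) = 1\<^sub>m ?n $$ (i, j)" using i j cN by simp
    qed (auto simp: Q_def)
    show "Q *\<^sub>v unit_vec ?n 0 = v"
    proof (intro eq_vecI)
      fix i assume "i < dim_vec v"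
      hence i: "i < ?n" using v by simp
      have "(Q *\<^sub>v unit_vec ?n 0) $ i = ?d i 0 - c * w i * w 0"
        using i unfolding Q_def by simp
      also have "\<dots> = v $ i"
      proof (cases "N = 0")
        case True
        hence "\<forall>i\<in>{0..<?n}. w i * w i = 0" unfolding N_def by (subst (asm) sum_nonneg_eq_0_iff) auto
        hence "w i = 0" using i by simp
        thus ?thesis unfolding w_def by simp
      next
        case False
        have "w 0 = - N / 2" unfolding w_def N by simp
        hence "c * w 0 = - 1" using False unfolding c_def by simp
        hence "c * w i * w 0 = - w i" by (metis mult.commute mult.left_commute mult_minus1)
        thus ?thesis unfolding w_def by simp
      qed
      finally show "(Q *\<^sub>v unit_vec ?n 0) $ i = v $ i" .
    qed (use v in \<open>auto simp: Q_def\<close>)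
  qed
qed

text \<open>Induction on the size: conjugating by a reflection that takes \<open>e\<^sub>0\<close> to a unit eigenvector makes
  \<open>e\<^sub>0\<close> an eigenvector, and symmetry then clears the first row along with the first column, leaving a
  symmetric block of smaller size.\<close>

lemma symmetric_orthogonal_diagonalization:
  fixes A :: "real mat"
  assumes "A \<in> carrier_mat n n" and "transpose_mat A = A"
  shows "\<exists>P d. P \<in> carrier_mat n n \<and> transpose_mat P * P = 1\<^sub>m n \<and>
    transpose_mat P * A * P = mat_diag n d"
  using assms
proof (induction n arbitrary: A)
  case 0
  show ?case
    by (rule exI[of _ "1\<^sub>m 0"], rule exI[of _ "\<lambda>_. 0"]) (use 0 in \<open>auto intro!: eq_matI simp: mat_diag_def\<close>)
next
  case (Suc m)
  let ?n = "Suc m"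
  let ?e = "unit_vec ?n 0 :: real vec"
  note A = Suc.prems(1)
  obtain v k where v: "v \<in> carrier_vec ?n" "v \<bullet> v = 1" and Av: "A *\<^sub>v v = k \<cdot>\<^sub>v v"
    using symmetric_unit_eigenvector[OF Suc.prems] by auto
  obtain Q where Q: "Q \<in> carrier_mat ?n ?n" and QT: "transpose_mat Q = Q"
    and QQ: "Q * Q = 1\<^sub>m ?n" and Qe: "Q *\<^sub>v ?e = v"
    using householder_reflection[OF v] by auto
  have Qv: "Q *\<^sub>v v = ?e"
  proof -
    have "Q *\<^sub>v v = (Q * Q) *\<^sub>v ?e" unfolding Qe[symmetric] using Q by simp
    thus ?thesis using QQ by simp
  qed
  define B where "B = Q * A * Q"
  have B: "B \<in> carrier_mat ?n ?n" unfolding B_def using Q A by simp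
  have "transpose_mat B = transpose_mat Q * (transpose_mat A * transpose_mat Q)"
    unfolding B_def using Q A by (subst transpose_mult[of _ ?n ?n _ ?n], simp_all)+
  hence BT: "transpose_mat B = B" unfolding B_def QT Suc.prems(2) using Q A by simp
  have bsym: "B $$ (i, j) = B $$ (j, i)" if "i < ?n" "j < ?n" for i j
    using that B arg_cong[OF BT, of "\<lambda>B. B $$ (i, j)"] by simp
  have "B *\<^sub>v ?e = Q *\<^sub>v (A *\<^sub>v (Q *\<^sub>v ?e))"
    unfolding B_def using Q A by (simp add: assoc_mult_mat_vec[of _ ?n ?n _ ?n])
  also have "\<dots> = k \<cdot>\<^sub>v ?e" unfolding Qe Av using Q v(1) Qv by (simp add: mult_mat_vec[of _ ?n ?n])
  finally have Be: "B *\<^sub>v ?e = k \<cdot>\<^sub>v ?e" .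
  have col0: "B $$ (i, 0) = (if i = 0 then k else 0)" if i: "i < ?n" for i
    using arg_cong[OF Be, of "\<lambda>w. w $ i"] i B by simp
  define C where "C = mat m m (\<lambda>(i, j). B $$ (Suc i, Suc j))"
  have C: "C \<in> carrier_mat m m" unfolding C_def by simp
  have "transpose_mat C = C" unfolding C_def by (intro eq_matI) (auto simp: bsym)
  then obtain P d where P: "P \<in> carrier_mat m m" and PP: "transpose_mat P * P = 1\<^sub>m m"
    and PCP: "transpose_mat P * C * P = mat_diag m d"
    using Suc.IH[OF C] by blast
  let ?K = "mat 1 1 (\<lambda>_. k)"
  have Bblock: "B = four_block_mat ?K (0\<^sub>m 1 m) (0\<^sub>m m 1) C"
    by (intro eq_matI) (use B col0 bsym in \<open>auto simp: C_def\<close>)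
  define R where "R = four_block_mat (1\<^sub>m 1) (0\<^sub>m 1 m) (0\<^sub>m m 1) P"
  have R: "R \<in> carrier_mat ?n ?n" unfolding R_def using four_block_carrier_mat[OF one_carrier_mat P, of 1] by simp
  have RT: "transpose_mat R = four_block_mat (1\<^sub>m 1) (0\<^sub>m 1 m) (0\<^sub>m m 1) (transpose_mat P)"
    unfolding R_def by (subst transpose_four_block_mat[OF one_carrier_mat zero_carrier_mat zero_carrier_mat P]) simp
  have RR: "transpose_mat R * R = 1\<^sub>m ?n"
    unfolding RT unfolding R_def
    by (subst mult_four_block_mat[of _ 1 1 _ m _ m _ _ 1 _ m]) (use P PP in auto)
  have RBR: "transpose_mat R * B * R = mat_diag ?n (case_nat k d)"
  proof -
    have "transpose_mat R * B = four_block_mat ?K (0\<^sub>m 1 m) (0\<^sub>m m 1) (transpose_mat P * C)"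
      unfolding RT Bblock
      by (subst mult_four_block_mat[of _ 1 1 _ m _ m _ _ 1 _ m]) (use P C in auto)
    also have "\<dots> * R = four_block_mat ?K (0\<^sub>m 1 m) (0\<^sub>m m 1) (transpose_mat P * C * P)"
      unfolding R_def
      by (subst mult_four_block_mat[of _ 1 1 _ m _ m _ _ 1 _ m]) (use P C in auto)
    finally show ?thesis
      unfolding PCP by (auto intro!: eq_matI simp: mat_diag_def split: nat.splits)
  qed
  have QRT: "transpose_mat (Q * R) = transpose_mat R * Q" using transpose_mult[OF Q R] QT by simp
  show ?case
  proof (intro exI conjI)
    show "Q * R \<in> carrier_mat ?n ?n" using Q R by simp
    have "transpose_mat (Q * R) * (Q * R) = transpose_mat R * ((Q * Q) * R)"
      unfolding QRT using Q R by (simp add: assoc_mult_mat[of _ ?n ?n _ ?n _ ?n])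
    thus "transpose_mat (Q * R) * (Q * R) = 1\<^sub>m ?n" unfolding QQ using R RR by simp
    have "transpose_mat (Q * R) * A * (Q * R) = transpose_mat R * B * R"
      unfolding QRT B_def using Q R A by (simp add: assoc_mult_mat[of _ ?n ?n _ ?n _ ?n])
    thus "transpose_mat (Q * R) * A * (Q * R) = mat_diag ?n (case_nat k d)" unfolding RBR .
  qed
qed

section \<open>Counting eigenvalues by a quadratic form\<close>

lemma order_char_poly_mat_diag:
  fixes d :: "nat \<Rightarrow> real"
  shows "Polynomial.order x (char_poly (mat_diag n d)) = card {i \<in> {0..<n}. d i = x}"
proof -
  have "char_poly (mat_diag n d) = (\<Prod>a\<leftarrow>diag_mat (mat_diag n d). [:- a, 1:])"
    by (rule char_poly_upper_triangular[of _ n]) (auto simp: mat_diag_def)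
  also have "diag_mat (mat_diag n d) = map d [0..<n]"
    unfolding diag_mat_def by (auto simp: mat_diag_def)
  finally have "Polynomial.order x (char_poly (mat_diag n d))
      = (\<Sum>i\<leftarrow>[0..<n]. Polynomial.order x [:- d i, 1:])"
    by (subst (asm) map_map) (simp add: o_def, subst order_prod_list, auto simp: o_def)
  also have "\<dots> = (\<Sum>i\<in>{0..<n}. if d i = x then 1 else 0)"
    by (subst sum_list_distinct_conv_sum_set) (auto simp: order_linear' intro!: sum.cong)
  also have "\<dots> = card {i \<in> {0..<n}. d i = x}" by (simp add: sum.If_cases Int_def)
  finally show ?thesis .
qed

text \<open>Eigenvalues are counted by their multiplicity as roots of the characteristic polynomial.  This
  turns the count into the number of diagonal entries, which is what dimension arguments deliver.\<close>

lemma num_eigenvalues_orthogonal_diagonalization: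
  fixes A :: "real mat"
  assumes A: "A \<in> carrier_mat n n" and P: "P \<in> carrier_mat n n"
    and PP: "transpose_mat P * P = 1\<^sub>m n" and D: "transpose_mat P * A * P = mat_diag n d"
  shows "num_eigenvalues A Q = card {i \<in> {0..<n}. Q (d i)}"
proof -
  have PP': "P * transpose_mat P = 1\<^sub>m n"
    using mat_mult_left_right_inverse[OF _ P PP] P by simp
  have "similar_mat (mat_diag n d) A"
    by (rule similar_matI[OF _ PP PP' D[symmetric]]) (use A P in auto)
  hence "char_poly A = char_poly (mat_diag n d)" by (metis char_poly_similar)
  hence ord: "Polynomial.order x (char_poly A) = card {i \<in> {0..<n}. d i = x}" for x
    by (simp add: order_char_poly_mat_diag)
  have "char_poly A \<noteq> 0" using degree_monic_char_poly[OF A] by auto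
  hence spec: "x \<in> spectrum A \<longleftrightarrow> {i \<in> {0..<n}. d i = x} \<noteq> {}" for x
    unfolding spectrum_root_char_poly[OF A] mem_Collect_eq order_root ord by simp
  have "num_eigenvalues A Q
      = (\<Sum>x\<in>{x \<in> spectrum A. Q x}. \<Sum>i\<in>{i \<in> {i \<in> {0..<n}. Q (d i)}. d i = x}. 1)"
    unfolding num_eigenvalues_def ord
    by (intro sum.cong refl) (auto intro!: arg_cong[of _ _ card])
  also have "\<dots> = (\<Sum>i\<in>{i \<in> {0..<n}. Q (d i)}. 1)"
    by (rule sum.group) (use card_finite_spectrum(1)[OF A] spec in auto)
  finally show ?thesis by simp
qed

text \<open>Fewer than \<open>n\<close> homogeneous linear equations in \<open>n\<close> unknowns have a nontrivial solution: padded with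
  zero rows, the square coefficient matrix is singular.\<close>

lemma exists_nonzero_orthogonal_vector:
  fixes F :: "real vec set"
  assumes F: "F \<subseteq> carrier_vec n" and fin: "finite F" and card: "card F < n"
  obtains x where "x \<in> carrier_vec n" "x \<noteq> 0\<^sub>v n" "\<And>f. f \<in> F \<Longrightarrow> f \<bullet> x = 0"
proof -
  obtain fs where fs: "set fs = F" "distinct fs" using finite_distinct_list[OF fin] by blast
  hence len: "length fs < n" using card distinct_card by fastforce
  define r where "r i = (if i < length fs then fs ! i else 0\<^sub>v n)" for i
  have r: "r i \<in> carrier_vec n" for i using F fs(1) unfolding r_def by auto
  define B where "B = mat n n (\<lambda>(i, j). r i $ j)"
  have B: "B \<in> carrier_mat n n" unfolding B_def by simp
  have row: "row B i = r i" if "i < n" for i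
    using that r[of i] unfolding B_def by (intro eq_vecI) auto
  have "transpose_mat B *\<^sub>v unit_vec n (length fs) = 0\<^sub>v n"
    by (intro eq_vecI) (use len in \<open>auto simp: B_def r_def\<close>)
  moreover have "unit_vec n (length fs) \<noteq> (0\<^sub>v n :: real vec)" using len by simp
  ultimately have "det (transpose_mat B) = 0"
    using B by (subst det_0_iff_vec_prod_zero_field[of _ n]) (auto intro!: exI[of _ "unit_vec n (length fs)"])
  hence "det B = 0" using det_transpose[OF B] by simp
  then obtain x where x: "x \<in> carrier_vec n" "x \<noteq> 0\<^sub>v n" "B *\<^sub>v x = 0\<^sub>v n"
    using det_0_iff_vec_prod_zero_field[OF B] by auto
  have "f \<bullet> x = 0" if "f \<in> F" for f
  proof -
    obtain i where i: "i < length fs" "f = fs ! i" using \<open>f \<in> F\<close> fs(1) by (metis in_set_conv_nth)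
    hence "row B i = f" using row[of i] len unfolding r_def by simp
    thus ?thesis using arg_cong[OF x(3), of "\<lambda>w. w $ i"] i(1) len B by simp
  qed
  thus thesis using that x by blast
qed

text \<open>The equations given by \<open>F\<close> together with orthogonality to all eigenvectors whose eigenvalue
  satisfies \<open>Q\<close> are too few to force \<open>x = 0\<close>.  So a vector in the common kernel of \<open>F\<close> exists whose
  Rayleigh quotient is a mean, with positive weights \<open>a i\<close>, of eigenvalues that all violate \<open>Q\<close>.\<close>

lemma exists_vector_in_complementary_eigenspaces:
  fixes A :: "real mat"
  assumes A: "A \<in> carrier_mat n n" and sym: "transpose_mat A = A"
    and F: "F \<subseteq> carrier_vec n" "finite F"
    and card: "card F + num_eigenvalues A Q < n"
  obtains x and J :: "nat set" and d a :: "nat \<Rightarrow> real"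
  where "x \<in> carrier_vec n" "\<And>f. f \<in> F \<Longrightarrow> f \<bullet> x = 0" "finite J" "J \<noteq> {}"
    "x \<bullet> (A *\<^sub>v x) = (\<Sum>i\<in>J. d i * a i)" "x \<bullet> x = (\<Sum>i\<in>J. a i)"
    "\<And>i. i \<in> J \<Longrightarrow> \<not> Q (d i) \<and> 0 < a i"
proof -
  obtain P d where P: "P \<in> carrier_mat n n" and PP: "transpose_mat P * P = 1\<^sub>m n"
    and D: "transpose_mat P * A * P = mat_diag n d"
    using symmetric_orthogonal_diagonalization[OF A sym] by blast
  let ?I = "{i \<in> {0..<n}. Q (d i)}"
  have "card (F \<union> col P ` ?I) \<le> card F + card ?I"
    using card_Un_le[of F "col P ` ?I"] card_image_le[of ?I "col P"] by simp
  hence "card (F \<union> col P ` ?I) < n"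
    using card num_eigenvalues_orthogonal_diagonalization[OF A P PP D, of Q] by linarith
  moreover have sub: "F \<union> col P ` ?I \<subseteq> carrier_vec n" using F(1) P by auto
  ultimately obtain x where x: "x \<in> carrier_vec n" "x \<noteq> 0\<^sub>v n"
    and orth: "\<And>f. f \<in> F \<union> col P ` ?I \<Longrightarrow> f \<bullet> x = 0"
    using exists_nonzero_orthogonal_vector[OF sub] F(2) by auto
  define y where "y = transpose_mat P *\<^sub>v x"
  have y: "y \<in> carrier_vec n" unfolding y_def using P x(1) by (intro mult_mat_vec_carrier[of _ n n]) auto
  have PT: "transpose_mat P \<in> carrier_mat n n" using P by simp
  have PP': "P * transpose_mat P = 1\<^sub>m n" using mat_mult_left_right_inverse[OF PT P PP] .
  have cancel: "P *\<^sub>v (transpose_mat P *\<^sub>v z) = z" if "z \<in> carrier_vec n" for z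
    using assoc_mult_mat_vec[OF P PT that] that unfolding PP' by simp
  have Py: "P *\<^sub>v y = x" unfolding y_def by (rule cancel[OF x(1)])
  have xAx: "x \<bullet> (A *\<^sub>v x) = (\<Sum>i\<in>{0..<n}. d i * (y $ i)\<^sup>2)"
  proof -
    have "x \<bullet> (A *\<^sub>v x) = x \<bullet> (P *\<^sub>v (transpose_mat P *\<^sub>v (A *\<^sub>v x)))"
      using A x(1) by (subst cancel) auto
    also have "\<dots> = y \<bullet> (transpose_mat P *\<^sub>v (A *\<^sub>v x))"
      unfolding y_def
      by (rule transpose_vec_mult_scalar[OF P _ x(1), symmetric])
        (use A PT x(1) in \<open>auto intro: mult_mat_vec_carrier\<close>)
    also have "\<dots> = y \<bullet> (transpose_mat P *\<^sub>v (A *\<^sub>v (P *\<^sub>v y)))"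
      unfolding Py ..
    also have "\<dots> = y \<bullet> (mat_diag n d *\<^sub>v y)"
      unfolding D[symmetric] using P A y by (simp add: assoc_mult_mat_vec[of _ n n _ n])
    also have "\<dots> = (\<Sum>i\<in>{0..<n}. d i * (y $ i)\<^sup>2)"
      using y by (auto simp: scalar_prod_def mat_diag_def power2_eq_square
        if_distrib[of "\<lambda>x. x * _"] cong: if_cong intro!: sum.cong)
    finally show ?thesis .
  qed
  have "x \<bullet> x = y \<bullet> y"
    using transpose_vec_mult_scalar[OF P y x(1)] unfolding y_def[symmetric] Py by simp
  hence xx: "x \<bullet> x = (\<Sum>i\<in>{0..<n}. (y $ i)\<^sup>2)"
    using y by (simp add: scalar_prod_def power2_eq_square)
  define J where "J = {i \<in> {0..<n}. y $ i \<noteq> 0}"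
  show thesis
  proof (rule that[of x J d "\<lambda>i. (y $ i)\<^sup>2"])
    show "x \<in> carrier_vec n" by fact
    show "f \<bullet> x = 0" if "f \<in> F" for f using orth that by simp
    show "finite J" unfolding J_def by simp
    show "J \<noteq> {}"
    proof
      assume "J = {}"
      hence "y = 0\<^sub>v n" using y unfolding J_def by (intro eq_vecI) auto
      hence "x = 0\<^sub>v n" using Py P by auto
      thus False using x(2) by simp
    qed
    show "x \<bullet> (A *\<^sub>v x) = (\<Sum>i\<in>J. d i * (y $ i)\<^sup>2)" "x \<bullet> x = (\<Sum>i\<in>J. (y $ i)\<^sup>2)"
      unfolding xAx xx J_def by (auto intro!: sum.mono_neutral_right)
    show "\<not> Q (d i) \<and> 0 < (y $ i)\<^sup>2" if "i \<in> J" for i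
      using orth[of "col P i"] that P unfolding y_def J_def by auto
  qed
qed

text \<open>One half of the Courant-Fischer principle, in terms of equations instead of subspaces: if the
  Rayleigh quotient is at most \<open>c\<close> on a subspace of codimension at most \<open>card F\<close>, then at least
  \<open>n - card F\<close> eigenvalues are at most \<open>c\<close>.  Describing the subspace by equations spares proofs of linear
  independence: dependent equations only make the bound weaker, not false.\<close>

lemma num_eigenvalues_le_bound:
  fixes A :: "real mat"
  assumes A: "A \<in> carrier_mat n n" and sym: "transpose_mat A = A"
    and F: "F \<subseteq> carrier_vec n" "finite F"
    and form: "\<And>x. x \<in> carrier_vec n \<Longrightarrow> (\<And>f. f \<in> F \<Longrightarrow> f \<bullet> x = 0) \<Longrightarrow> x \<bullet> (A *\<^sub>v x) \<le> c * (x \<bullet> x)"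
  shows "n \<le> card F + num_eigenvalues A (\<lambda>t. t \<le> c)"
proof (rule ccontr)
  assume "\<not> ?thesis"
  hence "card F + num_eigenvalues A (\<lambda>t. t \<le> c) < n" by simp
  from exists_vector_in_complementary_eigenspaces[OF A sym F this]
  obtain x J d a where x: "x \<in> carrier_vec n" "\<And>f. f \<in> F \<Longrightarrow> f \<bullet> x = 0"
    and J: "finite J" "J \<noteq> ({} :: nat set)"
    and sums: "x \<bullet> (A *\<^sub>v x) = (\<Sum>i\<in>J. d i * a i)" "x \<bullet> x = (\<Sum>i\<in>J. a i)"
    and weights: "\<And>i. i \<in> J \<Longrightarrow> \<not> d i \<le> c \<and> 0 < (a i :: real)"
    by blast
  have "(\<Sum>i\<in>J. c * a i) < (\<Sum>i\<in>J. d i * a i)"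
    by (rule sum_strict_mono[OF J]) (use weights in \<open>simp add: not_le\<close>)
  thus False using form[OF x] unfolding sums sum_distrib_left[symmetric] by simp
qed

lemma num_eigenvalues_ge_bound:
  fixes A :: "real mat"
  assumes A: "A \<in> carrier_mat n n" and sym: "transpose_mat A = A"
    and F: "F \<subseteq> carrier_vec n" "finite F"
    and form: "\<And>x. x \<in> carrier_vec n \<Longrightarrow> (\<And>f. f \<in> F \<Longrightarrow> f \<bullet> x = 0) \<Longrightarrow> x \<bullet> (A *\<^sub>v x) \<ge> c * (x \<bullet> x)"
  shows "n \<le> card F + num_eigenvalues A (\<lambda>t. t \<ge> c)"
proof (rule ccontr)
  assume "\<not> ?thesis"
  hence "card F + num_eigenvalues A (\<lambda>t. t \<ge> c) < n" by simp
  from exists_vector_in_complementary_eigenspaces[OF A sym F this]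
  obtain x J d a where x: "x \<in> carrier_vec n" "\<And>f. f \<in> F \<Longrightarrow> f \<bullet> x = 0"
    and J: "finite J" "J \<noteq> ({} :: nat set)"
    and sums: "x \<bullet> (A *\<^sub>v x) = (\<Sum>i\<in>J. d i * a i)" "x \<bullet> x = (\<Sum>i\<in>J. a i)"
    and weights: "\<And>i. i \<in> J \<Longrightarrow> \<not> d i \<ge> c \<and> 0 < (a i :: real)"
    by blast
  have "(\<Sum>i\<in>J. d i * a i) < (\<Sum>i\<in>J. c * a i)"
    by (rule sum_strict_mono[OF J]) (use weights in \<open>simp add: not_le\<close>)
  thus False using form[OF x] unfolding sums sum_distrib_left[symmetric] by simp
qed

lemma num_eigenvalues_split:
  assumes A: "A \<in> carrier_mat n n" and "\<And>t. \<not> (Q t \<and> R t)"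
  shows "num_eigenvalues A (\<lambda>t. Q t \<or> R t) = num_eigenvalues A Q + num_eigenvalues A R"
proof -
  have "{x \<in> spectrum A. Q x \<or> R x} = {x \<in> spectrum A. Q x} \<union> {x \<in> spectrum A. R x}" by auto
  thus ?thesis
    unfolding num_eigenvalues_def
    by (simp only:) (rule sum.union_disjoint, use assms card_finite_spectrum(1)[OF A] in auto)
qed

section \<open>A principal submatrix that comes from a clique\<close>

text \<open>The \<open>2n\<close> coordinates form two copies of \<open>{0..<n}\<close>, and the set \<open>I\<close> of clique vertices occurs in each
  copy.  The rows and columns in both copies of \<open>I\<close> carry the matrix with four blocks \<open>J - 1\<close>, \<open>J\<close> being
  the all-ones matrix.\<close>

locale doubled_clique_block =
  fixes M :: "real mat" and n :: nat and I :: "nat set"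
  assumes carrier: "M \<in> carrier_mat (n + n) (n + n)"
    and symmetric: "transpose_mat M = M"
    and I_sub: "I \<subseteq> {0..<n}" and I_nonempty: "I \<noteq> {}"
    and entries: "\<And>i j. i \<in> I \<Longrightarrow> j \<in> I \<Longrightarrow>
      M $$ (i, j) = of_bool (i \<noteq> j) \<and> M $$ (i, n + j) = of_bool (i \<noteq> j) \<and>
      M $$ (n + i, j) = of_bool (i \<noteq> j) \<and> M $$ (n + i, n + j) = of_bool (i \<noteq> j)"
begin

definition supported :: "real vec \<Rightarrow> bool" where
  "supported x \<longleftrightarrow> x \<in> carrier_vec (n + n) \<and> (\<forall>i\<in>{0..<n} - I. x $ i = 0 \<and> x $ (n + i) = 0)"

lemma finite_I: "finite I"
  using I_sub by (rule finite_subset) simp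

lemma sum_supported:
  assumes "\<And>i. i \<in> {0..<n} - I \<Longrightarrow> g i = 0 \<and> g (n + i) = 0"
  shows "(\<Sum>k\<in>{0..<n + n}. g k) = (\<Sum>i\<in>I. g i + g (n + i) :: real)"
proof -
  have "(\<Sum>k\<in>{0..<n + n}. g k) = (\<Sum>i\<in>{0..<n}. g i) + (\<Sum>i\<in>{0..<n}. g (n + i))"
    using sum.atLeastLessThan_concat[of 0 n "n + n" g] sum.shift_bounds_nat_ivl[of g 0 n n]
    by (simp add: add.commute)
  also have "\<dots> = (\<Sum>i\<in>{0..<n}. g i + g (n + i))" by (simp add: sum.distrib)
  also have "\<dots> = (\<Sum>i\<in>I. g i + g (n + i))"
    by (rule sum.mono_neutral_right) (use I_sub assms in auto)
  finally show ?thesis .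
qed

lemma supported_dim: "supported x \<Longrightarrow> dim_vec x = n + n"
  unfolding supported_def by (metis carrier_vecD)

lemma norm_supported:
  assumes x: "supported x"
  shows "x \<bullet> x = (\<Sum>i\<in>I. (x $ i)\<^sup>2 + (x $ (n + i))\<^sup>2)"
proof -
  have "x \<bullet> x = (\<Sum>k\<in>{0..<n + n}. (x $ k)\<^sup>2)"
    using supported_dim[OF x] by (simp add: scalar_prod_def power2_eq_square)
  also have "\<dots> = (\<Sum>i\<in>I. (x $ i)\<^sup>2 + (x $ (n + i))\<^sup>2)"
    by (rule sum_supported) (use x in \<open>auto simp: supported_def\<close>)
  finally show ?thesis .
qed

text \<open>On vectors supported on the clique the form depends only on the sums \<open>u i\<close> of the two
  coordinates at the same vertex, because all four blocks are equal; each block is \<open>J - 1\<close>, whose form is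
  the square of the sum minus the sum of squares.\<close>

lemma form_supported:
  assumes x: "supported x"
  shows "x \<bullet> (M *\<^sub>v x)
    = (\<Sum>i\<in>I. x $ i + x $ (n + i))\<^sup>2 - (\<Sum>i\<in>I. (x $ i + x $ (n + i))\<^sup>2)"
proof -
  define u where "u i = x $ i + x $ (n + i)" for i
  have xc: "x \<in> carrier_vec (n + n)" using x unfolding supported_def by simp
  have Mx: "(M *\<^sub>v x) $ k = (\<Sum>j\<in>I. M $$ (k, j) * x $ j + M $$ (k, n + j) * x $ (n + j))"
    if "k < n + n" for k
  proof -
    have "(M *\<^sub>v x) $ k = (\<Sum>l\<in>{0..<n + n}. M $$ (k, l) * x $ l)"
      using that xc carrier by (simp add: scalar_prod_def)
    also have "\<dots> = (\<Sum>j\<in>I. M $$ (k, j) * x $ j + M $$ (k, n + j) * x $ (n + j))"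
      by (rule sum_supported) (use x in \<open>auto simp: supported_def\<close>)
    finally show ?thesis .
  qed
  have row: "(\<Sum>j\<in>I. of_bool (i \<noteq> j) * u j) = (\<Sum>j\<in>I. u j) - u i" if "i \<in> I" for i
  proof -
    have "(\<Sum>j\<in>I. of_bool (i \<noteq> j) * u j) = (\<Sum>j\<in>I. u j - (if i = j then u j else 0))"
      by (intro sum.cong) auto
    thus ?thesis using that finite_I by (simp add: sum_subtractf)
  qed
  have Mi: "(M *\<^sub>v x) $ i = (\<Sum>j\<in>I. u j) - u i \<and> (M *\<^sub>v x) $ (n + i) = (\<Sum>j\<in>I. u j) - u i"
    if i: "i \<in> I" for i
  proof -
    have "i < n" using i I_sub by auto
    hence "(M *\<^sub>v x) $ i = (\<Sum>j\<in>I. of_bool (i \<noteq> j) * u j)"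
      "(M *\<^sub>v x) $ (n + i) = (\<Sum>j\<in>I. of_bool (i \<noteq> j) * u j)"
      using entries[OF i] by (auto simp: Mx u_def distrib_left intro!: sum.cong)
    thus ?thesis using row[OF i] by simp
  qed
  have "x \<bullet> (M *\<^sub>v x) = (\<Sum>k\<in>{0..<n + n}. x $ k * (M *\<^sub>v x) $ k)"
    using xc carrier by (simp add: scalar_prod_def)
  also have "\<dots> = (\<Sum>i\<in>I. x $ i * (M *\<^sub>v x) $ i + x $ (n + i) * (M *\<^sub>v x) $ (n + i))"
    by (rule sum_supported) (use x in \<open>auto simp: supported_def\<close>)
  also have "\<dots> = (\<Sum>i\<in>I. u i * (\<Sum>j\<in>I. u j) - (u i)\<^sup>2)"
  proof (intro sum.cong refl)
    fix i assume "i \<in> I"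
    thus "x $ i * (M *\<^sub>v x) $ i + x $ (n + i) * (M *\<^sub>v x) $ (n + i)
        = u i * (\<Sum>j\<in>I. u j) - (u i)\<^sup>2"
      using Mi[of i] by (simp only:) (simp add: u_def[of i] algebra_simps power2_eq_square)
  qed
  also have "\<dots> = (\<Sum>i\<in>I. u i)\<^sup>2 - (\<Sum>i\<in>I. (u i)\<^sup>2)"
    by (simp add: sum_subtractf sum_distrib_right[symmetric] power2_eq_square)
  finally show ?thesis unfolding u_def .
qed

definition support_constraints :: "real vec set" where
  "support_constraints = unit_vec (n + n) ` (({0..<n} - I) \<union> (+) n ` ({0..<n} - I))"

lemma card_I_le: "card I \<le> n"
  using card_mono[OF _ I_sub] by simp

lemma card_support_constraints: "card support_constraints + 2 * card I \<le> 2 * n"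
proof -
  let ?J = "{0..<n} - I"
  have J: "card ?J = n - card I" using I_sub finite_I by (simp add: card_Diff_subset)
  have "card support_constraints \<le> card (?J \<union> (+) n ` ?J)"
    unfolding support_constraints_def by (rule card_image_le) simp
  also have "\<dots> \<le> card ?J + card ((+) n ` ?J)" by (rule card_Un_le)
  also have "card ((+) n ` ?J) \<le> card ?J" by (rule card_image_le) simp
  finally have "card support_constraints \<le> card ?J + card ?J" by simp
  thus ?thesis using J card_I_le by linarith
qed

lemma support_constraints_carrier:
  "support_constraints \<subseteq> carrier_vec (n + n)" "finite support_constraints"
  unfolding support_constraints_def by auto

lemma supportedI:
  assumes x: "x \<in> carrier_vec (n + n)" and f: "\<And>f. f \<in> support_constraints \<Longrightarrow> f \<bullet> x = 0"
  shows "supported x"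
  unfolding supported_def
proof (intro conjI x ballI)
  fix i assume i: "i \<in> {0..<n} - I"
  show "x $ i = 0" using f[of "unit_vec (n + n) i"] i x unfolding support_constraints_def by auto
  show "x $ (n + i) = 0"
    using f[of "unit_vec (n + n) (n + i)"] i x unfolding support_constraints_def by auto
qed

text \<open>Passing from the whole space to vectors supported on the clique costs one equation for each of the
  \<open>2n - 2 card I\<close> other coordinates, so \<open>2 card I\<close> takes the place of the size of the matrix.\<close>

lemma num_eigenvalues_le_on_block:
  assumes E: "E \<subseteq> carrier_vec (n + n)" "finite E"
    and form: "\<And>x. supported x \<Longrightarrow> (\<And>f. f \<in> E \<Longrightarrow> f \<bullet> x = 0) \<Longrightarrow>
      (\<Sum>i\<in>I. x $ i + x $ (n + i))\<^sup>2 - (\<Sum>i\<in>I. (x $ i + x $ (n + i))\<^sup>2)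
        \<le> c * (\<Sum>i\<in>I. (x $ i)\<^sup>2 + (x $ (n + i))\<^sup>2)"
  shows "2 * card I \<le> card E + num_eigenvalues M (\<lambda>t. t \<le> c)"
proof -
  have "n + n \<le> card (support_constraints \<union> E) + num_eigenvalues M (\<lambda>t. t \<le> c)"
    by (rule num_eigenvalues_le_bound[OF carrier symmetric])
      (use E support_constraints_carrier form in
        \<open>auto simp: supportedI form_supported norm_supported\<close>)
  thus ?thesis
    using card_support_constraints card_Un_le[of support_constraints E] by linarith
qed

lemma num_eigenvalues_ge_on_block:
  assumes E: "E \<subseteq> carrier_vec (n + n)" "finite E"
    and form: "\<And>x. supported x \<Longrightarrow> (\<And>f. f \<in> E \<Longrightarrow> f \<bullet> x = 0) \<Longrightarrow>
      (\<Sum>i\<in>I. x $ i + x $ (n + i))\<^sup>2 - (\<Sum>i\<in>I. (x $ i + x $ (n + i))\<^sup>2)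
        \<ge> c * (\<Sum>i\<in>I. (x $ i)\<^sup>2 + (x $ (n + i))\<^sup>2)"
  shows "2 * card I \<le> card E + num_eigenvalues M (\<lambda>t. t \<ge> c)"
proof -
  have "n + n \<le> card (support_constraints \<union> E) + num_eigenvalues M (\<lambda>t. t \<ge> c)"
    by (rule num_eigenvalues_ge_bound[OF carrier symmetric])
      (use E support_constraints_carrier form in
        \<open>auto simp: supportedI form_supported norm_supported\<close>)
  thus ?thesis
    using card_support_constraints card_Un_le[of support_constraints E] by linarith
qed

lemma minus_unit_vec_scalar_prod:
  assumes "supported x" "k < n + n" "l < n + n"
  shows "(unit_vec (n + n) k - unit_vec (n + n) l) \<bullet> x = x $ k - x $ l"
  using assms unfolding supported_def by (simp add: minus_scalar_prod_distrib[of _ "n + n"])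

lemma ones_scalar_prod:
  assumes x: "supported x"
  shows "vec (n + n) (\<lambda>_. 1) \<bullet> x = (\<Sum>i\<in>I. x $ i + x $ (n + i))"
proof -
  have "vec (n + n) (\<lambda>_. 1) \<bullet> x = (\<Sum>k\<in>{0..<n + n}. x $ k)"
    using supported_dim[OF x] by (simp add: scalar_prod_def)
  also have "\<dots> = (\<Sum>i\<in>I. x $ i + x $ (n + i))"
    by (rule sum_supported) (use x in \<open>auto simp: supported_def\<close>)
  finally show ?thesis .
qed

section \<open>Five test subspaces\<close>

text \<open>The \<open>2 card I - 1\<close> equations leave the constant vectors on the clique.  With constant \<open>t\<close> all sums
  \<open>u i\<close> are \<open>2 t\<close>, and the Rayleigh quotient is \<open>2 (card I - 1)\<close>.\<close>

lemma exists_large_eigenvalue: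
  "1 \<le> num_eigenvalues M (\<lambda>t. t \<ge> 2 * (real (card I) - 1))"
proof -
  let ?w = "real (card I)"
  obtain p where p: "p \<in> I" using I_nonempty by blast
  let ?K = "(I - {p}) \<union> (+) n ` I"
  let ?E = "(\<lambda>k. unit_vec (n + n) k - unit_vec (n + n) p :: real vec) ` ?K"
  have K: "k < n + n" if "k \<in> ?K \<or> k = p" for k using that I_sub p by auto
  have "2 * card I \<le> card ?E + num_eigenvalues M (\<lambda>t. t \<ge> 2 * (?w - 1))"
  proof (rule num_eigenvalues_ge_on_block)
    fix x assume x: "supported x" and E: "\<And>f. f \<in> ?E \<Longrightarrow> f \<bullet> x = 0"
    have eq: "x $ k = x $ p" if "k \<in> ?K" for k
      using E[of "unit_vec (n + n) k - unit_vec (n + n) p"] that K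
        minus_unit_vec_scalar_prod[OF x, of k p] by auto
    hence "x $ i = x $ p" "x $ (n + i) = x $ p" if "i \<in> I" for i
      using that by (cases "i = p"; auto)+
    thus "(\<Sum>i\<in>I. x $ i + x $ (n + i))\<^sup>2 - (\<Sum>i\<in>I. (x $ i + x $ (n + i))\<^sup>2)
        \<ge> 2 * (?w - 1) * (\<Sum>i\<in>I. (x $ i)\<^sup>2 + (x $ (n + i))\<^sup>2)"
      by (simp add: power2_eq_square algebra_simps)
  qed (use finite_I in auto)
  moreover have "card ?E < 2 * card I"
  proof -
    have "card ?E \<le> card ?K" using finite_I by (intro card_image_le) simp
    also have "\<dots> \<le> card (I - {p}) + card ((+) n ` I)" by (rule card_Un_le)
    also have "card ((+) n ` I) \<le> card I" using finite_I by (rule card_image_le)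
    finally show ?thesis using card_Diff1_less[OF finite_I p] by linarith
  qed
  ultimately show ?thesis by linarith
qed

text \<open>If the coordinates add up to 0, only the negative part of the form survives.\<close>

lemma count_nonpositive: "2 * card I \<le> 1 + num_eigenvalues M (\<lambda>t. t \<le> 0)"
proof -
  let ?E = "{vec (n + n) (\<lambda>_. 1)} :: real vec set"
  have "2 * card I \<le> card ?E + num_eigenvalues M (\<lambda>t. t \<le> 0)"
  proof (rule num_eigenvalues_le_on_block)
    fix x assume x: "supported x" and "\<And>f. f \<in> ?E \<Longrightarrow> f \<bullet> x = 0"
    hence "(\<Sum>i\<in>I. x $ i + x $ (n + i)) = 0" using ones_scalar_prod[OF x] by simp
    thus "(\<Sum>i\<in>I. x $ i + x $ (n + i))\<^sup>2 - (\<Sum>i\<in>I. (x $ i + x $ (n + i))\<^sup>2)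
        \<le> 0 * (\<Sum>i\<in>I. (x $ i)\<^sup>2 + (x $ (n + i))\<^sup>2)"
      by (simp add: sum_nonneg)
  qed auto
  thus ?thesis by simp
qed

text \<open>If all sums \<open>u i\<close> have the same value \<open>t\<close>, the form is \<open>w (w - 1) t\<^sup>2\<close> with \<open>w = card I \<ge> 1\<close>.
  These are \<open>w - 1\<close> equations; the coordinates in one copy and \<open>t\<close> remain free.\<close>

lemma count_nonnegative: "card I + 1 \<le> num_eigenvalues M (\<lambda>t. t \<ge> 0)"
proof -
  obtain p where p: "p \<in> I" using I_nonempty by blast
  let ?g = "\<lambda>i. (unit_vec (n + n) i + unit_vec (n + n) (n + i))
    - (unit_vec (n + n) p + unit_vec (n + n) (n + p)) :: real vec"
  let ?E = "?g ` (I - {p})"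
  have "2 * card I \<le> card ?E + num_eigenvalues M (\<lambda>t. t \<ge> 0)"
  proof (rule num_eigenvalues_ge_on_block)
    fix x assume x: "supported x" and E: "\<And>f. f \<in> ?E \<Longrightarrow> f \<bullet> x = 0"
    define t where "t = x $ p + x $ (n + p)"
    have eq: "x $ i + x $ (n + i) = t" if "i \<in> I" for i
    proof (cases "i = p")
      case False
      have "i < n" "p < n" using that p I_sub by auto
      moreover have "x \<in> carrier_vec (n + n)" using x unfolding supported_def by simp
      ultimately have "?g i \<bullet> x = x $ i + x $ (n + i) - t" unfolding t_def
        by (simp add: minus_scalar_prod_distrib[of _ "n + n"] add_scalar_prod_distrib[of _ "n + n"])
      thus ?thesis using E[of "?g i"] that False by auto
    qed (simp add: t_def)
    have w: "real (card I) \<ge> 1" using p finite_I by (simp add: Suc_le_eq card_gt_0_iff I_nonempty)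
    have "(\<Sum>i\<in>I. x $ i + x $ (n + i))\<^sup>2 - (\<Sum>i\<in>I. (x $ i + x $ (n + i))\<^sup>2)
        = (real (card I) * (real (card I) - 1)) * t\<^sup>2"
      using eq by (simp add: power2_eq_square algebra_simps)
    also have "\<dots> \<ge> 0" using w by simp
    finally show "(\<Sum>i\<in>I. x $ i + x $ (n + i))\<^sup>2 - (\<Sum>i\<in>I. (x $ i + x $ (n + i))\<^sup>2)
        \<ge> 0 * (\<Sum>i\<in>I. (x $ i)\<^sup>2 + (x $ (n + i))\<^sup>2)"
      by simp
  qed (use finite_I in auto)
  moreover have "card ?E \<le> card (I - {p})" using finite_I by (intro card_image_le) simp
  ultimately show ?thesis using card_Diff1_less[OF finite_I p] by linarith
qed

text \<open>If the two coordinates at each vertex agree and the total is 0, then \<open>u i\<close> is twice either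
  coordinate, and the form is exactly \<open>- 2\<close> times the squared norm.\<close>

lemma count_le_minus_two: "card I \<le> num_eigenvalues M (\<lambda>t. t \<le> - 2) + 1"
proof -
  let ?g = "\<lambda>i. unit_vec (n + n) i - unit_vec (n + n) (n + i) :: real vec"
  let ?E = "insert (vec (n + n) (\<lambda>_. 1)) (?g ` I)"
  have "2 * card I \<le> card ?E + num_eigenvalues M (\<lambda>t. t \<le> - 2)"
  proof (rule num_eigenvalues_le_on_block)
    fix x assume x: "supported x" and E: "\<And>f. f \<in> ?E \<Longrightarrow> f \<bullet> x = 0"
    have z: "(\<Sum>i\<in>I. x $ i + x $ (n + i)) = 0"
      using E[of "vec (n + n) (\<lambda>_. 1)"] ones_scalar_prod[OF x] by simp
    have eq: "x $ (n + i) = x $ i" if "i \<in> I" for i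
    proof -
      have "i < n" using that I_sub by auto
      thus ?thesis using E[of "?g i"] that minus_unit_vec_scalar_prod[OF x, of i "n + i"] by auto
    qed
    have "(\<Sum>i\<in>I. (x $ i + x $ (n + i))\<^sup>2) = (\<Sum>i\<in>I. 2 * ((x $ i)\<^sup>2 + (x $ (n + i))\<^sup>2))"
      by (intro sum.cong refl) (simp add: eq power2_eq_square)
    thus "(\<Sum>i\<in>I. x $ i + x $ (n + i))\<^sup>2 - (\<Sum>i\<in>I. (x $ i + x $ (n + i))\<^sup>2)
        \<le> - 2 * (\<Sum>i\<in>I. (x $ i)\<^sup>2 + (x $ (n + i))\<^sup>2)"
      unfolding z by (simp add: sum_distrib_left)
  qed (use finite_I in auto)
  moreover have "card ?E \<le> Suc (card (?g ` I))" using finite_I by (simp add: card_insert_if)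
  moreover have "card (?g ` I) \<le> card I" using finite_I by (rule card_image_le)
  ultimately show ?thesis by linarith
qed

text \<open>The bound \<open>(a + b)\<^sup>2 \<le> 2 (a\<^sup>2 + b\<^sup>2)\<close> makes \<open>- 2\<close> a lower bound for the Rayleigh quotient on all vectors
  supported on the clique, without further equations.\<close>

lemma count_ge_minus_two: "2 * card I \<le> num_eigenvalues M (\<lambda>t. t \<ge> - 2)"
proof -
  have "2 * card I \<le> card ({} :: real vec set) + num_eigenvalues M (\<lambda>t. t \<ge> - 2)"
  proof (rule num_eigenvalues_ge_on_block)
    fix x :: "real vec"
    have "(\<Sum>i\<in>I. (x $ i + x $ (n + i))\<^sup>2) \<le> (\<Sum>i\<in>I. 2 * ((x $ i)\<^sup>2 + (x $ (n + i))\<^sup>2))"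
    proof (rule sum_mono)
      fix i
      have "0 \<le> (x $ i - x $ (n + i))\<^sup>2" by simp
      thus "(x $ i + x $ (n + i))\<^sup>2 \<le> 2 * ((x $ i)\<^sup>2 + (x $ (n + i))\<^sup>2)"
        by (simp add: power2_eq_square algebra_simps)
    qed
    moreover have "0 \<le> (\<Sum>i\<in>I. x $ i + x $ (n + i))\<^sup>2" by simp
    ultimately show "(\<Sum>i\<in>I. x $ i + x $ (n + i))\<^sup>2 - (\<Sum>i\<in>I. (x $ i + x $ (n + i))\<^sup>2)
        \<ge> - 2 * (\<Sum>i\<in>I. (x $ i)\<^sup>2 + (x $ (n + i))\<^sup>2)"
      unfolding sum_distrib_left[symmetric] by linarith
  qed auto
  thus ?thesis by simp
qed

end

section \<open>Cliques in the integrated adjacency matrix\<close>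

lemma edge_matrix_carrier: "edge_matrix G vs \<in> carrier_mat (length vs) (length vs)"
  unfolding edge_matrix_def by simp

lemma arc_matrix_carrier: "arc_matrix G vs \<in> carrier_mat (length vs) (length vs)"
  unfolding arc_matrix_def by simp

lemma integrated_adjacency_matrix_carrier:
  "integrated_adjacency_matrix G vs \<in> carrier_mat (length vs + length vs) (length vs + length vs)"
  unfolding integrated_adjacency_matrix_def
  by (rule four_block_carrier_mat[OF edge_matrix_carrier edge_matrix_carrier])

lemma integrated_adjacency_matrix_symmetric:
  "transpose_mat (integrated_adjacency_matrix G vs) = integrated_adjacency_matrix G vs"
proof -
  have "transpose_mat (edge_matrix G vs) = edge_matrix G vs"
    unfolding edge_matrix_def edges_joining_def by (intro eq_matI) (auto simp: Upair_inject intro!: arg_cong[of _ _ card])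
  thus ?thesis
    unfolding integrated_adjacency_matrix_def
    by (subst transpose_four_block_mat[OF edge_matrix_carrier arc_matrix_carrier _ edge_matrix_carrier])
      (use arc_matrix_carrier in auto)
qed

text \<open>Completeness of the clique gives at least one edge or arc, and this edge or arc already belongs to \<open>G\<close>;
  simplicity of \<open>G\<close> gives at most one.\<close>

lemma clique_joined:
  assumes G: "simple_mixed_graph G" and H: "clique G H"
    and uv: "u \<in> verts H" "v \<in> verts H"
  shows "card (edges_joining G u v) = of_bool (u \<noteq> v)"
    "card (arcs_from_to G u v) = of_bool (u \<noteq> v)"
proof -
  have sub: "submixed_graph H G" and comp: "complete_mixed_graph H"
    using H unfolding clique_def by auto
  have uvG: "u \<in> verts G" "v \<in> verts G" using sub uv unfolding submixed_graph_def by auto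
  have fin: "finite (edges_joining G u v)" "finite (arcs_from_to G u v)"
    using G unfolding simple_mixed_graph_def wf_mixed_graph_def edges_joining_def arcs_from_to_def by auto
  have le: "card (edges_joining G u v) \<le> 1" "card (arcs_from_to G u v) \<le> 1"
    using G uvG unfolding simple_mixed_graph_def by auto
  have "edges_joining G u v \<noteq> {} \<and> arcs_from_to G u v \<noteq> {}" if "u \<noteq> v"
  proof -
    have "edges_joining H u v \<noteq> {}" "arcs_from_to H u v \<noteq> {}"
      using comp uv that unfolding complete_mixed_graph_def by auto
    moreover have "edges_joining H u v \<subseteq> edges_joining G u v" "arcs_from_to H u v \<subseteq> arcs_from_to G u v"
      using sub unfolding submixed_graph_def edges_joining_def arcs_from_to_def by auto
    ultimately show ?thesis by auto
  qed
  hence "u \<noteq> v \<Longrightarrow> card (edges_joining G u v) > 0 \<and> card (arcs_from_to G u v) > 0"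
    using fin by (simp add: card_gt_0_iff)
  moreover have "u = v \<Longrightarrow> card (edges_joining G u v) = 0 \<and> card (arcs_from_to G u v) = 0"
    using G uvG unfolding simple_mixed_graph_def by auto
  ultimately show "card (edges_joining G u v) = of_bool (u \<noteq> v)"
    "card (arcs_from_to G u v) = of_bool (u \<noteq> v)"
    using le by (cases "u = v"; force)+
qed

lemma clique_doubled_block:
  assumes G: "simple_mixed_graph G" and vs: "distinct vs" "set vs = verts G"
    and H: "clique G H"
  defines "I \<equiv> {i \<in> {0..<length vs}. vs ! i \<in> verts H}"
  shows "doubled_clique_block (integrated_adjacency_matrix G vs) (length vs) I"
    and "card I = card (verts H)"
proof -
  have sub: "verts H \<subseteq> set vs" and ne: "verts H \<noteq> {}"
    using H vs(2) unfolding clique_def submixed_graph_def wf_mixed_graph_def by auto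
  have img: "(!) vs ` I = verts H"
  proof
    show "verts H \<subseteq> (!) vs ` I"
    proof
      fix v assume v: "v \<in> verts H"
      then obtain i where "i < length vs" "vs ! i = v" using sub by (metis in_set_conv_nth subsetD)
      thus "v \<in> (!) vs ` I" using v unfolding I_def by auto
    qed
  qed (auto simp: I_def)
  have "inj_on ((!) vs) I"
    using vs(1) unfolding I_def by (auto simp: inj_on_def nth_eq_iff_index_eq)
  thus "card I = card (verts H)" using card_image img by metis
  show "doubled_clique_block (integrated_adjacency_matrix G vs) (length vs) I"
  proof
    show "integrated_adjacency_matrix G vs \<in> carrier_mat (length vs + length vs) (length vs + length vs)"
      by (rule integrated_adjacency_matrix_carrier)
    show "transpose_mat (integrated_adjacency_matrix G vs) = integrated_adjacency_matrix G vs"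
      by (rule integrated_adjacency_matrix_symmetric)
    show "I \<subseteq> {0..<length vs}" unfolding I_def by auto
    show "I \<noteq> {}" using img ne by auto
    fix i j assume "i \<in> I" "j \<in> I"
    hence i: "i < length vs" "vs ! i \<in> verts H" and j: "j < length vs" "vs ! j \<in> verts H"
      unfolding I_def by auto
    have eq: "vs ! i = vs ! j \<longleftrightarrow> i = j" using vs(1) i(1) j(1) by (simp add: nth_eq_iff_index_eq)
    have A: "edge_matrix G vs $$ (i, j) = of_bool (i \<noteq> j)"
      using i j eq clique_joined(1)[OF G H i(2) j(2)] by (auto simp: edge_matrix_def)
    have D: "arc_matrix G vs $$ (i, j) = of_bool (i \<noteq> j)" "arc_matrix G vs $$ (j, i) = of_bool (i \<noteq> j)"
      using i j eq clique_joined(2)[OF G H i(2) j(2)] clique_joined(2)[OF G H j(2) i(2)]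
      by (auto simp: arc_matrix_def)
    show "integrated_adjacency_matrix G vs $$ (i, j) = of_bool (i \<noteq> j) \<and>
      integrated_adjacency_matrix G vs $$ (i, length vs + j) = of_bool (i \<noteq> j) \<and>
      integrated_adjacency_matrix G vs $$ (length vs + i, j) = of_bool (i \<noteq> j) \<and>
      integrated_adjacency_matrix G vs $$ (length vs + i, length vs + j) = of_bool (i \<noteq> j)"
      using i(1) j(1) A D edge_matrix_carrier[of G vs] arc_matrix_carrier[of G vs]
      unfolding integrated_adjacency_matrix_def by simp
  qed
qed

text \<open>The maximum in the definition of the clique number is over a nonempty finite set, since a single
  vertex is a clique.\<close>

lemma clique_number_attained:
  fixes G :: "('v, 'e, 'a) mixed_graph"
  assumes G: "simple_mixed_graph G"
  obtains H where "clique G H" "card (verts H) = clique_number G"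
proof -
  let ?S = "{card (verts H) | H. clique G H}"
  have wf: "wf_mixed_graph G" using G unfolding simple_mixed_graph_def by simp
  have "?S \<subseteq> {..card (verts G)}"
    using wf by (auto simp: clique_def submixed_graph_def wf_mixed_graph_def intro: card_mono)
  hence fin: "finite ?S" by (rule finite_subset) simp
  obtain v where v: "v \<in> verts G" using wf unfolding wf_mixed_graph_def by auto
  define H :: "('v, 'e, 'a) mixed_graph" where
    "H = \<lparr>verts = {v}, edges = {}, arcs = {}, ends = ends G, tail = tail G, head = head G\<rparr>"
  have "wf_mixed_graph H" unfolding H_def wf_mixed_graph_def by simp
  hence "clique G H"
    using wf v
    by (auto simp: clique_def submixed_graph_def complete_mixed_graph_def simple_mixed_graph_def
        edges_joining_def arcs_from_to_def) (auto simp: H_def)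
  hence "?S \<noteq> {}" by blast
  hence "clique_number G \<in> ?S" unfolding clique_number_def by (rule Max_in[OF fin])
  thus thesis using that by auto
qed

theorem theorem8p11:
  fixes G :: "('v, 'e, 'a) mixed_graph"
    and vs :: "'v list"
    and M :: "real mat"
    and p_neg p_zero p_pos q_neg q_zero q_pos :: nat
    and s :: real
  assumes "simple_mixed_graph G"
    and "distinct vs" and "set vs = verts G"
    and "M = integrated_adjacency_matrix G vs"
    and "p_neg = num_eigenvalues M (\<lambda>x. x < 0)"
    and "p_zero = num_eigenvalues M (\<lambda>x. x = 0)"
    and "p_pos = num_eigenvalues M (\<lambda>x. x > 0)"
    and "q_neg = num_eigenvalues M (\<lambda>x. x < -2)"
    and "q_zero = num_eigenvalues M (\<lambda>x. x = -2)"
    and "q_pos = num_eigenvalues M (\<lambda>x. x > -2)"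
    and "s = Min {1 + largest_eigenvalue M / 2,
                  (real p_zero + real p_neg + 1) / 2,
                  real p_zero + real p_pos - 1,
                  real q_zero + real q_neg + 1,
                  (real q_zero + real q_pos) / 2}"
  shows "real (clique_number G) \<le> s"
proof -
  note counts = assms(5-10)
  obtain H where H: "clique G H" "card (verts H) = clique_number G"
    using clique_number_attained[OF assms(1)] .
  define I where "I = {i \<in> {0..<length vs}. vs ! i \<in> verts H}"
  define w where "w = clique_number G"
  have cardI: "card I = w"
    using clique_doubled_block(2)[OF assms(1-3) H(1)] H(2) unfolding I_def w_def by simp
  interpret doubled_clique_block M "length vs" I
    using clique_doubled_block(1)[OF assms(1-3) H(1)] unfolding I_def assms(4) .
  have split: "num_eigenvalues M (\<lambda>t. t \<le> c) = num_eigenvalues M (\<lambda>t. t = c) + num_eigenvalues M (\<lambda>t. t < c)"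
    "num_eigenvalues M (\<lambda>t. t \<ge> c) = num_eigenvalues M (\<lambda>t. t = c) + num_eigenvalues M (\<lambda>t. t > c)" for c
    using num_eigenvalues_split[OF carrier, of "\<lambda>t. t = c" "\<lambda>t. t < c"]
      num_eigenvalues_split[OF carrier, of "\<lambda>t. t = c" "\<lambda>t. t > c"]
    by (auto simp: order_le_less disj_commute eq_commute)
  have "{t \<in> spectrum M. t \<ge> 2 * (real w - 1)} \<noteq> {}"
    using exists_large_eigenvalue unfolding cardI num_eigenvalues_def by (metis not_one_le_zero sum.empty)
  then obtain t where t: "t \<in> spectrum M" "t \<ge> 2 * (real w - 1)" by blast
  have "t \<le> largest_eigenvalue M"
    unfolding largest_eigenvalue_def using card_finite_spectrum(1)[OF carrier] t(1) by (rule Max_ge)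
  hence "real w \<le> 1 + largest_eigenvalue M / 2" using t(2) by (simp add: field_simps)
  moreover have "2 * w \<le> 1 + (p_zero + p_neg)"
    using count_nonpositive unfolding cardI split counts by simp
  moreover have "w + 1 \<le> p_zero + p_pos"
    using count_nonnegative unfolding cardI split counts by simp
  moreover have "w \<le> q_zero + q_neg + 1"
    using count_le_minus_two unfolding cardI split counts by simp
  moreover have "2 * w \<le> q_zero + q_pos"
    using count_ge_minus_two unfolding cardI split counts by simp
  ultimately show ?thesis unfolding assms(11) w_def[symmetric] by simp
qed

end
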